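(* Let $f=\sum_{n=0}^\infty a_n z^n\in \mathbb{Z}[[z]]$ be such that $a_0=\pm p^k$ for some prime $p$ and positive integer $k\geq 2$. Suppose there exists a positive integer $m$ for which $$p^\ell\mid a_{(k-\ell)m+i},\qquad p^{\ell+1}\nmid a_{(k-\ell)m+i},$$ for every $i=1,\ldots,m$ and for every $\ell=1,\ldots,k$. If $p$ does not divide $a_{km+1}$, then $f$ is irreducible in $\mathbb{Z}[[z]]$.
   Context: $\mathbb{Z}[[z]]$ denotes the ring of formal power series in $z$ over $\mathbb{Z}$. *)

theory Defs
  imports
    "HOL-Computational_Algebra.Formal_Power_Series"
    "HOL-Computational_Algebra.Primes"
begin

end

theory Submission
  imports Defs
begin

text \<open>
  The argument is Dumas's: a Newton polygon with a single edge that carries no interior lattice point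
  forbids a factorisation. Let \<open>v\<close> be the \<open>p\<close>-adic valuation and put \<open>N = k * m + 1\<close>. The divisibility
  hypotheses place every point \<open>(i, v (f $ i))\<close> on or above the segment from \<open>(0, k)\<close> to \<open>(N, 0)\<close>,
  that is, every nonzero coefficient has weight \<open>N * v (f $ i) + k * i \<ge> k * N\<close>. Since
  \<open>gcd N k = 1\<close>, the segment meets the lattice only at its ends.

  The minimal weight is additive under multiplication of power series
  (\<open>min_weight_mult\<close>), a form of Gauss's lemma. Suppose \<open>f = g * h\<close> with neither factor a unit.
  A power series is a unit exactly when its constant term is a unit, so \<open>v (g $ 0) = s\<close> and
  \<open>v (h $ 0) = t\<close> with \<open>s, t > 0\<close> and \<open>s + t = k\<close>. As \<open>p\<close> does not divide \<open>f $ N\<close>, there are indices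
  \<open>x + y = N\<close> with \<open>v (g $ x) = v (h $ y) = 0\<close>. The minimal weight of \<open>g\<close> is thus at most
  \<open>N * s\<close> and at most \<open>k * x\<close>, that of \<open>h\<close> at most \<open>N * t\<close> and at most \<open>k * y\<close>. The two minima add up
  to at least \<open>k * N = N * s + N * t = k * x + k * y\<close>, so all these bounds are equalities, and
  \<open>N * s = k * x\<close>. By coprimality \<open>k\<close> divides \<open>s\<close>, which is impossible for \<open>0 < s < k\<close>.
\<close>

text \<open>
  The level lines of the weight in the plane of the points \<open>(i, v (g $ i))\<close> have slope \<open>- k / N\<close>;
  clearing the denominator keeps the weight in \<open>nat\<close>. At a zero coefficient the value is
  meaningless, since the multiplicity of \<open>0\<close> is \<open>0\<close> by convention and not infinite.
\<close>

definition newton_weight ::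
    "'a \<Rightarrow> nat \<Rightarrow> nat \<Rightarrow> 'a::factorial_semiring fps \<Rightarrow> nat \<Rightarrow> nat" where
  "newton_weight p N k g i = N * multiplicity p (fps_nth g i) + k * i"

lemma first_minimum_exists:
  fixes w :: "nat \<Rightarrow> nat"
  assumes "P i0"
  obtains i where "P i" "\<And>j. P j \<Longrightarrow> w i \<le> w j" "\<And>j. P j \<Longrightarrow> j < i \<Longrightarrow> w i < w j"
proof -
  obtain a where a: "P a" "\<And>j. P j \<Longrightarrow> w a \<le> w j"
    using ex_has_least_nat[of P i0 w] assms by blast
  define i where "i = (LEAST i. P i \<and> w i = w a)"
  have i: "P i \<and> w i = w a"
    unfolding i_def by (rule LeastI[where k = a]) (use a in simp)
  have "w i < w j" if "P j" "j < i" for j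
  proof -
    have "w j \<noteq> w a"
      using not_less_Least[of j "\<lambda>i. P i \<and> w i = w a"] that unfolding i_def by blast
    then show ?thesis
      using a(2)[OF that(1)] i by simp
  qed
  then show thesis
    using that[of i] i a(2) by simp
qed

text \<open>
  The proof is that of Gauss's lemma. Take for \<open>i\<close> and \<open>j\<close> the first indices at which the weight
  is minimal. Every other product that contributes to the coefficient of the product series at \<open>i + j\<close>
  has its first factor before \<open>i\<close> or its second before \<open>j\<close>, hence strictly larger total weight; the index
  parts of the weights being equal, it is divisible by a higher power of \<open>p\<close> and cannot cancel
  the term of \<open>i\<close> and \<open>j\<close>.
\<close>

lemma min_weight_mult:
  fixes g h :: "'a::{factorial_semiring,idom} fps" and p :: 'a
  assumes p: "prime_elem p" and g: "g \<noteq> 0" and h: "h \<noteq> 0"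
  obtains i j where
    "\<And>l. fps_nth g l \<noteq> 0 \<Longrightarrow> newton_weight p N k g i \<le> newton_weight p N k g l"
    "\<And>l. fps_nth h l \<noteq> 0 \<Longrightarrow> newton_weight p N k h j \<le> newton_weight p N k h l"
    "fps_nth (g * h) (i + j) \<noteq> 0"
    "newton_weight p N k (g * h) (i + j) = newton_weight p N k g i + newton_weight p N k h j"
proof -
  let ?v = "multiplicity p" and ?w = "newton_weight p N k"
  obtain i0 where "fps_nth g i0 \<noteq> 0" using g by (auto simp: fps_eq_iff)
  then obtain i where i: "fps_nth g i \<noteq> 0" "\<And>l. fps_nth g l \<noteq> 0 \<Longrightarrow> ?w g i \<le> ?w g l"
      "\<And>l. fps_nth g l \<noteq> 0 \<Longrightarrow> l < i \<Longrightarrow> ?w g i < ?w g l"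
    using first_minimum_exists[of "\<lambda>l. fps_nth g l \<noteq> 0" i0 "?w g"] by metis
  obtain j0 where "fps_nth h j0 \<noteq> 0" using h by (auto simp: fps_eq_iff)
  then obtain j where j: "fps_nth h j \<noteq> 0" "\<And>l. fps_nth h l \<noteq> 0 \<Longrightarrow> ?w h j \<le> ?w h l"
      "\<And>l. fps_nth h l \<noteq> 0 \<Longrightarrow> l < j \<Longrightarrow> ?w h j < ?w h l"
    using first_minimum_exists[of "\<lambda>l. fps_nth h l \<noteq> 0" j0 "?w h"] by metis
  define e where "e = ?v (fps_nth g i) + ?v (fps_nth h j)"
  have e: "?v (fps_nth g i * fps_nth h j) = e"
    using prime_elem_multiplicity_mult_distrib[OF p i(1) j(1)] e_def by simp
  have other: "p ^ Suc e dvd fps_nth g l * fps_nth h (i + j - l)"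
    if l: "l \<in> {0..i + j} - {i}" for l
  proof (cases "fps_nth g l = 0 \<or> fps_nth h (i + j - l) = 0")
    case False
    define r where "r = i + j - l"
    have lr: "l + r = i + j" using l by (auto simp: r_def)
    have ne: "fps_nth g l \<noteq> 0" "fps_nth h r \<noteq> 0" using False by (auto simp: r_def)
    have "l < i \<or> r < j" using l lr by auto
    then have "?w g i + ?w h j < ?w g l + ?w h r"
      using i(2,3)[OF ne(1)] j(2,3)[OF ne(2)] by (meson add_le_less_mono add_less_le_mono)
    then have "N * e + k * (i + j) < N * (?v (fps_nth g l) + ?v (fps_nth h r)) + k * (l + r)"
      by (simp add: newton_weight_def e_def algebra_simps)
    then have "N * e < N * (?v (fps_nth g l) + ?v (fps_nth h r))"
      using lr by simp
    then have "Suc e \<le> ?v (fps_nth g l) + ?v (fps_nth h r)"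
      by simp
    also have "\<dots> = ?v (fps_nth g l * fps_nth h r)"
      using prime_elem_multiplicity_mult_distrib[OF p ne] by simp
    finally show ?thesis
      unfolding r_def by (rule multiplicity_dvd')
  qed auto
  have coeff: "fps_nth (g * h) (i + j) = fps_nth g i * fps_nth h j
      + (\<Sum>l\<in>{0..i + j} - {i}. fps_nth g l * fps_nth h (i + j - l))"
    by (simp add: fps_mult_nth sum.remove[of "{0..i + j}" i])
  have rest: "p ^ Suc e dvd (\<Sum>l\<in>{0..i + j} - {i}. fps_nth g l * fps_nth h (i + j - l))"
    by (rule dvd_sum) (rule other)
  have "p ^ e dvd fps_nth g i * fps_nth h j"
    using multiplicity_dvd[of p "fps_nth g i * fps_nth h j"] e by simp
  then have dvd: "p ^ e dvd fps_nth (g * h) (i + j)"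
    unfolding coeff using rest by (meson dvd_add dvd_trans le_imp_power_dvd le_SucI le_refl)
  have "\<not> p ^ Suc e dvd fps_nth g i * fps_nth h j"
    using i(1) j(1) p e by (subst power_dvd_iff_le_multiplicity) (auto simp: prime_elem_def)
  then have ndvd: "\<not> p ^ Suc e dvd fps_nth (g * h) (i + j)"
    unfolding coeff using rest by (simp only: dvd_add_left_iff not_False_eq_True)
  have "?w (g * h) (i + j) = ?w g i + ?w h j"
    using multiplicity_eqI[OF dvd ndvd]
    by (simp add: newton_weight_def e_def algebra_simps)
  moreover have "fps_nth (g * h) (i + j) \<noteq> 0"
    using ndvd by (metis dvd_0_right)
  ultimately show thesis
    using that[of i j] i(2) j(2) by blast
qed

lemma fps_dvd_1_iff_nth_0_dvd_1:
  fixes f :: "'a::comm_ring_1 fps"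
  shows "f dvd 1 \<longleftrightarrow> fps_nth f 0 dvd 1"
  using fps_is_left_unit_iff_zeroth_is_left_unit[of f] by (simp add: dvd_def)

lemma prime_dvd_nonunit_divisor_of_prime_power:
  fixes p :: "'a::factorial_semiring"
  assumes p: "prime p" and a: "a dvd p ^ k" "\<not> is_unit a"
  shows "p dvd a"
proof -
  obtain l where l: "normalize a = normalize (p ^ l)"
    using divides_primepow_weak[OF p a(1)] by blast
  have "l \<noteq> 0"
    using l a(2) by (metis associated_unit power_0 is_unit_normalize one_dvd normalize_1 normalize_1_iff)
  then have "p dvd p ^ l" by (simp add: dvd_power)
  then show ?thesis
    using l by (metis dvd_normalize_iff)
qed

text \<open>
  A Dumas-type criterion: the points \<open>(i, v (f $ i))\<close> lie on or above the segment from \<open>(0, k)\<close> to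
  \<open>(N, 0)\<close>, both of whose ends are attained. That the constant term is a power of \<open>p\<close> up to a unit
  is what turns non-units into factors whose constant term is divisible by \<open>p\<close>.
\<close>

theorem fps_irreducible_newton_segment:
  fixes f :: "'a::{factorial_semiring,idom} fps" and p :: 'a and k N :: nat
  assumes p: "prime p" and k: "k > 0" and cop: "coprime N k"
    and f0: "normalize (fps_nth f 0) = normalize (p ^ k)"
    and above: "\<And>i. fps_nth f i \<noteq> 0 \<Longrightarrow> k * N \<le> newton_weight p N k f i"
    and fN: "\<not> p dvd fps_nth f N"
  shows "irreducible f"
proof (rule irreducibleI)
  let ?v = "multiplicity p" and ?w = "newton_weight p N k"
  have pe: "prime_elem p" using p by (rule prime_imp_prime_elem)
  have p_ne: "p \<noteq> 0" "\<not> is_unit p" using p by auto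
  show f_ne: "f \<noteq> 0" using fN by auto
  have f0_dvd: "fps_nth f 0 dvd p ^ k"
    using f0 by (metis associated_iff_dvd)
  have "p dvd fps_nth f 0"
    using f0 k by (metis associated_iff_dvd dvd_power dvd_trans)
  then show "\<not> f dvd 1"
    using p_ne(2) by (auto simp: fps_dvd_1_iff_nth_0_dvd_1 intro: dvd_trans)
  fix g h assume fgh: "f = g * h"
  show "g dvd 1 \<or> h dvd 1"
  proof (rule ccontr)
    assume "\<not> (g dvd 1 \<or> h dvd 1)"
    then have nonunit: "\<not> is_unit (fps_nth g 0)" "\<not> is_unit (fps_nth h 0)"
      by (auto simp: fps_dvd_1_iff_nth_0_dvd_1)
    have c0: "fps_nth f 0 = fps_nth g 0 * fps_nth h 0"
      using fgh by simp
    have c0_ne: "fps_nth g 0 \<noteq> 0" "fps_nth h 0 \<noteq> 0"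
      using f0_dvd c0 p_ne(1) by auto
    define s where "s = ?v (fps_nth g 0)"
    define t where "t = ?v (fps_nth h 0)"
    have "fps_nth g 0 dvd p ^ k" "fps_nth h 0 dvd p ^ k"
      using f0_dvd c0 by (auto intro: dvd_mult_left dvd_mult_right)
    then have "p dvd fps_nth g 0" "p dvd fps_nth h 0"
      using prime_dvd_nonunit_divisor_of_prime_power[OF p] nonunit by auto
    then have st_pos: "s > 0" "t > 0"
      using c0_ne p_ne by (auto simp: s_def t_def multiplicity_gt_zero_iff)
    have "s + t = ?v (fps_nth f 0)"
      unfolding s_def t_def c0 using prime_elem_multiplicity_mult_distrib[OF pe c0_ne] by simp
    also have "\<dots> = ?v (normalize (p ^ k))"
      using f0 by (metis multiplicity_normalize_right)
    also have "\<dots> = k"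
      using p_ne by (simp add: multiplicity_same_power)
    finally have st: "s + t = k" .
    have "\<not> p dvd (\<Sum>l=0..N. fps_nth g l * fps_nth h (N - l))"
      using fN fgh by (simp add: fps_mult_nth)
    then obtain x where x: "x \<le> N" "\<not> p dvd fps_nth g x * fps_nth h (N - x)"
      by (meson atLeastAtMost_iff dvd_sum)
    define y where "y = N - x"
    have xy: "x + y = N" using x(1) by (simp add: y_def)
    have ndvd: "\<not> p dvd fps_nth g x" "\<not> p dvd fps_nth h y"
      using x(2) by (auto simp: y_def)
    have ne: "g \<noteq> 0" "h \<noteq> 0" using f_ne fgh by auto
    obtain i j where
      i: "\<And>l. fps_nth g l \<noteq> 0 \<Longrightarrow> ?w g i \<le> ?w g l" and
      j: "\<And>l. fps_nth h l \<noteq> 0 \<Longrightarrow> ?w h j \<le> ?w h l" and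
      ij: "fps_nth (g * h) (i + j) \<noteq> 0" "?w (g * h) (i + j) = ?w g i + ?w h j"
      using min_weight_mult[OF pe ne, of N k] by metis
    have lower: "k * N \<le> ?w g i + ?w h j"
      using above[of "i + j"] ij fgh by simp
    have gs: "?w g i \<le> N * s" and ht: "?w h j \<le> N * t"
      using i[OF c0_ne(1)] j[OF c0_ne(2)] by (simp_all add: newton_weight_def s_def t_def)
    have "fps_nth g x \<noteq> 0" "fps_nth h y \<noteq> 0" using ndvd by auto
    then have gx: "?w g i \<le> k * x" and hy: "?w h j \<le> k * y"
      using i[of x] j[of y] ndvd by (simp_all add: newton_weight_def not_dvd_imp_multiplicity_0)
    have "N * s + N * t = k * N" "k * x + k * y = k * N"
      using st xy by (metis distrib_left mult.commute)+
    then have "N * s = k * x"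
      using lower gs ht gx hy by linarith
    then have "k dvd s"
      using cop by (metis coprime_commute coprime_dvd_mult_right_iff dvd_triv_left)
    then show False
      using st st_pos by (auto dest: dvd_imp_le)
  qed
qed

text \<open>
  What remains is to see that the staircase of the hypotheses lies above the segment. An index
  \<open>i = q * m + r\<close> with \<open>1 \<le> r \<le> m\<close> and \<open>q < k\<close> belongs to the step of height \<open>k - q\<close>, and its weight
  exceeds \<open>k * N\<close> by at least \<open>k * r - q \<ge> k - q\<close>; from \<open>N = k * m + 1\<close> on, the term \<open>k * i\<close> alone suffices.
\<close>

theorem theorem5:
  fixes f :: "int fps" and p k m :: nat
  assumes "prime p" and "k \<ge> 2"
    and "fps_nth f 0 = int p ^ k \<or> fps_nth f 0 = - (int p ^ k)"
    and "m \<ge> 1"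
    and "\<And>i l. i \<in> {1..m} \<Longrightarrow> l \<in> {1..k} \<Longrightarrow>
           int p ^ l dvd fps_nth f ((k - l) * m + i) \<and>
           \<not> int p ^ (l + 1) dvd fps_nth f ((k - l) * m + i)"
    and "\<not> int p dvd fps_nth f (k * m + 1)"
  shows "irreducible f"
proof (rule fps_irreducible_newton_segment)
  let ?N = "k * m + 1"
  show "prime (int p)" using assms(1) by simp
  show "k > 0" using assms(2) by simp
  show "coprime ?N k"
    by (metis coprime_1_left coprime_mult_self_left_iff coprime_commute gcd_add_mult coprime_iff_gcd_eq_1 gcd.commute mult.commute)
  show f0: "normalize (fps_nth f 0) = normalize (int p ^ k)"
    using assms(3) by auto
  show "\<not> int p dvd fps_nth f ?N" by (rule assms(6))
  fix i assume ne: "fps_nth f i \<noteq> 0"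
  consider "i = 0" | "i \<ge> ?N" | "1 \<le> i" "i \<le> k * m" by linarith
  then show "k * ?N \<le> newton_weight (int p) ?N k f i"
  proof cases
    case 1
    have "multiplicity (int p) (fps_nth f 0) = multiplicity (int p) (int p ^ k)"
      using f0 by (metis multiplicity_normalize_right)
    also have "\<dots> = k"
      using assms(1) by (intro multiplicity_same_power) (auto simp: prime_gt_0_nat)
    finally show ?thesis
      using 1 by (simp add: newton_weight_def)
  next
    case 2
    then have "k * ?N \<le> k * i" by (rule mult_le_mono2)
    then show ?thesis by (simp add: newton_weight_def)
  next
    case 3
    \<comment> \<open>Dividing \<open>i - 1\<close> instead of \<open>i\<close> makes the remainder run over \<open>1..m\<close>.\<close>
    define q where "q = (i - 1) div m"
    define r where "r = (i - 1) mod m + 1"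
    have i: "i = q * m + r"
      using 3(1) by (simp add: q_def r_def)
    have r: "1 \<le> r" "r \<le> m"
      using assms(4) by (simp_all add: r_def Suc_le_eq)
    have "q * m < k * m"
      using i r(1) 3(2) by linarith
    then have q: "q < k" by simp
    define l where "l = k - q"
    have l: "l \<in> {1..k}" "k - l = q" "k = q + l"
      using q by (auto simp: l_def)
    have "int p ^ l dvd fps_nth f i"
      using assms(5)[of r l] r l i by simp
    then have v: "l \<le> multiplicity (int p) (fps_nth f i)"
      using ne assms(1) by (intro multiplicity_geI) (auto simp: prime_nat_iff)
    have "k * ?N = k * (q * m) + k * (l * m) + q + l"
      using l(3) by (simp add: algebra_simps)
    also have "\<dots> \<le> k * (q * m) + k * (l * m) + k * r + l"
      using r(1) q by (simp add: order_trans[OF less_imp_le[OF q]])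
    also have "\<dots> = ?N * l + k * i"
      by (simp add: i algebra_simps)
    also have "\<dots> \<le> newton_weight (int p) ?N k f i"
      unfolding newton_weight_def using v by (intro add_right_mono mult_le_mono2)
    finally show ?thesis .
  qed
qed

end
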